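(* Let $\delta$ be a binary $m \times r$ matrix with unordered GLT structure and let $s \in \mathbb{N}_0$. Then: (a) If $\delta$ violates the counting rule $\mathrm{CR}(r,s)$, then the extended row deletion property $\mathrm{RD}(r,s)$ is violated for all $\beta \in \Theta_\delta$. (b) If $\delta$ satisfies the counting rule $\mathrm{CR}(r,s)$, then the extended row deletion property $\mathrm{RD}(r,s)$ holds for all $\beta \in \Theta_\delta$ except for a set of measure $0$.
   Context: For a real $m \times r$ matrix with $r$ non-zero columns, the pivot row $l_j$ of column $j$ is the row index of the first non-zero entry in column $j$. A real $m\times r$ matrix of full column rank $r$ has an unordered GLT (generalized lower triangular) structure if its pivot rows $l_1,\ldots,l_r$ are pairwise distinct. A binary ($0/1$) $m \times r$ matrix $\delta$ has unordered GLT structure if it has no zero column and its pivot rows are pairwise distinct. The sparsity matrix of a real matrix $\beta$ is the binary matrix $\delta$ of the same size with $\delta_{ij} = 1$ iff $\beta_{ij} \ne 0$. Extended row deletion property $\mathrm{RD}(r,s)$: a real $m \times r$ matrix $\beta$ satisfies $\mathrm{RD}(r,s)$, $s \in \mathbb{N}_0$, if $m\ge s$ and, whenever $s$ rows are deleted from $\beta$, two disjoint submatrices (formed from disjoint sets of the remaining rows) of rank $r$ remain. Counting rule $\mathrm{CR}(r,s)$: a binary $m \times r$ matrix $\delta$ satisfies $\mathrm{CR}(r,s)$, $s\in\mathbb{N}_0$, if for every $q = 1,\ldots,r$, every submatrix built from $q$ columns of $\delta$ has at least $2q + s$ non-zero rows. $\Theta_\delta$ is the set of all unordered GLT matrices $\beta\in\mathbb{R}^{m\times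 r}$ with sparsity matrix $\delta$ together with all their signed permutations $\beta P_{\pm} P_\rho$, where $P_\pm$ is a diagonal matrix with diagonal entries $\pm 1$ and $P_\rho$ is an $r\times r$ permutation matrix. The non-zero entries are unconstrained, so $\Theta_\delta$ is a finite union of sets each parametrized by the non-zero entries ($d$ of them, where $d$ is the number of ones in $\delta$), and "measure $0$" refers to $d$-dimensional Lebesgue measure in these coordinates. *)

theory Defs
  imports
    "HOL-Analysis.Lebesgue_Measure"
    "HOL-Analysis.Complete_Measure"
    "Jordan_Normal_Form.DL_Rank"
    "Jordan_Normal_Form.DL_Submatrix"
begin

definition binary_mat :: "nat mat \<Rightarrow> bool" where
  "binary_mat A \<longleftrightarrow> elements_mat A \<subseteq> {0, 1}"

text \<open>The pivot row of a zero column is unspecified; it is only used for matrices without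
  zero columns. Row and column indices start at 0.\<close>

definition pivot_row :: "'a::zero mat \<Rightarrow> nat \<Rightarrow> nat" where
  "pivot_row A j = (LEAST i. i < dim_row A \<and> A $$ (i, j) \<noteq> 0)"

definition distinct_pivots :: "'a::zero mat \<Rightarrow> bool" where
  "distinct_pivots A \<longleftrightarrow> inj_on (pivot_row A) {0..<dim_col A}"

definition binary_unordered_GLT :: "nat mat \<Rightarrow> bool" where
  "binary_unordered_GLT \<delta> \<longleftrightarrow>
     binary_mat \<delta> \<and> (\<forall>j<dim_col \<delta>. col \<delta> j \<noteq> 0\<^sub>v (dim_row \<delta>)) \<and> distinct_pivots \<delta>"

definition unordered_GLT :: "real mat \<Rightarrow> bool" where
  "unordered_GLT \<beta> \<longleftrightarrow>
     vec_space.rank (dim_row \<beta>) \<beta> = dim_col \<beta> \<and> distinct_pivots \<beta>"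

definition sparsity_mat :: "real mat \<Rightarrow> nat mat" where
  "sparsity_mat \<beta> = map_mat (\<lambda>x. if x \<noteq> 0 then 1 else 0) \<beta>"

definition row_submatrix :: "'a mat \<Rightarrow> nat set \<Rightarrow> 'a mat" where
  "row_submatrix A I = submatrix A I UNIV"

definition col_submatrix :: "'a mat \<Rightarrow> nat set \<Rightarrow> 'a mat" where
  "col_submatrix A J = submatrix A UNIV J"

text \<open>The property RD(r,s), with r the number of columns of the matrix.
  \<open>D\<close> is the set of deleted rows.\<close>

definition RD :: "nat \<Rightarrow> real mat \<Rightarrow> bool" where
  "RD s \<beta> \<longleftrightarrow> s \<le> dim_row \<beta> \<and>
     (\<forall>D. D \<subseteq> {0..<dim_row \<beta>} \<and> card D = s \<longrightarrow>
        (\<exists>A B. A \<subseteq> {0..<dim_row \<beta>} - D \<and> B \<subseteq> {0..<dim_row \<beta>} - D \<and> A \<inter> B = {} \<and>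
           vec_space.rank (card A) (row_submatrix \<beta> A) = dim_col \<beta> \<and>
           vec_space.rank (card B) (row_submatrix \<beta> B) = dim_col \<beta>))"

definition nonzero_rows :: "'a::zero mat \<Rightarrow> nat set" where
  "nonzero_rows A = {i. i < dim_row A \<and> Matrix.row A i \<noteq> 0\<^sub>v (dim_col A)}"

text \<open>The counting rule CR(r,s), with r the number of columns of the matrix.\<close>

definition CR :: "nat \<Rightarrow> nat mat \<Rightarrow> bool" where
  "CR s \<delta> \<longleftrightarrow>
     (\<forall>q \<in> {1..dim_col \<delta>}. \<forall>J. J \<subseteq> {0..<dim_col \<delta>} \<and> card J = q \<longrightarrow>
        2 * q + s \<le> card (nonzero_rows (col_submatrix \<delta> J)))"

definition sign_mat :: "nat \<Rightarrow> real mat \<Rightarrow> bool" where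
  "sign_mat r P \<longleftrightarrow>
     P \<in> carrier_mat r r \<and> diagonal_mat P \<and> (\<forall>i<r. P $$ (i, i) = 1 \<or> P $$ (i, i) = -1)"

definition permutation_mat :: "nat \<Rightarrow> real mat \<Rightarrow> bool" where
  "permutation_mat r P \<longleftrightarrow>
     (\<exists>\<rho>. \<rho> permutes {0..<r} \<and> P = mat r r (\<lambda>(i, j). if i = \<rho> j then 1 else 0))"

definition GLT_matrices :: "nat mat \<Rightarrow> real mat set" where
  "GLT_matrices \<delta> = {\<beta>. unordered_GLT \<beta> \<and> sparsity_mat \<beta> = \<delta>}"

definition Theta :: "nat mat \<Rightarrow> real mat set" where
  "Theta \<delta> = {\<beta> * P * R | \<beta> P R.
     \<beta> \<in> GLT_matrices \<delta> \<and> sign_mat (dim_col \<delta>) P \<and> permutation_mat (dim_col \<delta>) R}"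

definition support :: "nat mat \<Rightarrow> (nat \<times> nat) set" where
  "support \<delta> = {(i, j). i < dim_row \<delta> \<and> j < dim_col \<delta> \<and> \<delta> $$ (i, j) \<noteq> 0}"

definition matrix_of_entries :: "nat mat \<Rightarrow> (nat \<times> nat \<Rightarrow> real) \<Rightarrow> real mat" where
  "matrix_of_entries \<delta> x =
     mat (dim_row \<delta>) (dim_col \<delta>) (\<lambda>ij. if ij \<in> support \<delta> then x ij else 0)"

text \<open>\<open>Theta \<delta>\<close> is the union, over the finitely many signed permutations \<open>P * R\<close>, of the images
  of the charts \<open>x \<mapsto> matrix_of_entries \<delta> x * P * R\<close>, where \<open>x\<close> ranges over the vectors of
  entries, indexed by the positions of the ones of \<open>\<delta>\<close>, that give a matrix in
  \<open>GLT_matrices \<delta>\<close>. A subset of \<open>Theta \<delta>\<close> has measure zero if its preimage under every chart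
  is a null set for the (completed) Lebesgue measure of dimension \<open>card (support \<delta>)\<close>. Indexing
  the coordinates by the entries of the signed permutation of the matrix instead would only
  permute coordinates and change their signs, which does not affect null sets.\<close>

definition measure_zero_in_Theta :: "nat mat \<Rightarrow> real mat set \<Rightarrow> bool" where
  "measure_zero_in_Theta \<delta> N \<longleftrightarrow> N \<subseteq> Theta \<delta> \<and>
     (\<forall>P R. sign_mat (dim_col \<delta>) P \<and> permutation_mat (dim_col \<delta>) R \<longrightarrow>
        {x \<in> support \<delta> \<rightarrow>\<^sub>E UNIV.
           matrix_of_entries \<delta> x \<in> GLT_matrices \<delta> \<and> matrix_of_entries \<delta> x * P * R \<in> N}
        \<in> null_sets (completion (\<Pi>\<^sub>M ij \<in> support \<delta>. lborel)))"

end

theory Submission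
  imports Defs
begin

text \<open>If \<open>q\<close> columns have fewer than \<open>2 * q + s\<close> non-zero rows, delete \<open>s\<close> of these rows: one of
  any two disjoint sets of remaining rows meets fewer than \<open>q\<close> of the non-zero rows, so the
  \<open>q\<close> columns restricted to it are linearly dependent. Conversely, under the counting rule
  Hall's theorem, applied to the rows outside a set of \<open>s\<close> deleted rows and to two copies of
  each column, yields two disjoint row sets matched with all columns. The corresponding two
  minors are polynomials in the entries which do not vanish at the indicator of the matching,
  so each vanishes only on a null set, and there are finitely many deletions.\<close>

section \<open>Hall's marriage theorem\<close>

definition hall_condition :: "'i set \<Rightarrow> ('i \<Rightarrow> 'a set) \<Rightarrow> bool" where
  "hall_condition I A \<longleftrightarrow> (\<forall>J\<subseteq>I. card J \<le> card (\<Union>(A ` J)))"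

text \<open>If both deletions failed, there would be violating families \<open>J\<close> and
  \<open>K\<close> avoiding \<open>i\<close>. Their unions \<open>?X\<close> and \<open>?Y\<close>
  together cover \<open>A i\<close>, because \<open>x\<close> and \<open>y\<close> differ, and
  \<open>?X \<inter> ?Y\<close> contains the union over \<open>J \<inter> K\<close>. Hall's
  condition for \<open>insert i (J \<union> K)\<close> and for \<open>J \<inter> K\<close>, added
  up, gives \<open>card J + card K + 1 \<le> card J + card K\<close>.\<close>

lemma hall_condition_delete:
  assumes fin: "finite I" "\<And>i. i \<in> I \<Longrightarrow> finite (A i)" and hall: "hall_condition I A"
    and i: "i \<in> I" and xy: "x \<in> A i" "y \<in> A i" "x \<noteq> y"
  shows "hall_condition I (A(i := A i - {x})) \<or> hall_condition I (A(i := A i - {y}))"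
proof (rule ccontr)
  \<comment> \<open>A violating family must contain \<open>i\<close>, as the other sets are
    unchanged. Removing \<open>i\<close> from it turns the strict inequality into \<le>.\<close>
  have step: "\<exists>J. J \<subseteq> I - {i} \<and> card (\<Union>(A ` J) \<union> (A i - {z})) \<le> card J"
    if "\<not> hall_condition I (A(i := A i - {z}))" for z
  proof -
    have "\<exists>J. J \<subseteq> I \<and> card (\<Union>((A(i := A i - {z})) ` J)) < card J"
      using that by (simp only: hall_condition_def not_all not_imp not_le)
    then obtain J where J: "J \<subseteq> I" "card (\<Union>((A(i := A i - {z})) ` J)) < card J"
      by (elim exE conjE)
    have "i \<in> J"
    proof (rule ccontr)
      assume "i \<notin> J"
      then have "(A(i := A i - {z})) ` J = A ` J" by (auto simp: image_iff)
      with J hall show False unfolding hall_condition_def by (metis not_le)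
    qed
    then have "(A(i := A i - {z})) ` J = insert (A i - {z}) ((A(i := A i - {z})) ` (J - {i}))"
      by (metis fun_upd_same image_insert insert_Diff)
    also have "(A(i := A i - {z})) ` (J - {i}) = A ` (J - {i})"
      by (intro image_cong) auto
    finally have "\<Union>((A(i := A i - {z})) ` J) = \<Union>(A ` (J - {i})) \<union> (A i - {z})"
      by (simp add: Un_commute)
    moreover have "card J = Suc (card (J - {i}))"
      using \<open>i \<in> J\<close> J(1) fin(1) by (metis card.remove finite_subset)
    ultimately show ?thesis using J by (intro exI[of _ "J - {i}"]) auto
  qed
  assume "\<not> (hall_condition I (A(i := A i - {x})) \<or> hall_condition I (A(i := A i - {y})))"
  then obtain J K where J: "J \<subseteq> I - {i}" "card (\<Union>(A ` J) \<union> (A i - {x})) \<le> card J"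
    and K: "K \<subseteq> I - {i}" "card (\<Union>(A ` K) \<union> (A i - {y})) \<le> card K"
    using step by meson
  let ?X = "\<Union>(A ` J) \<union> (A i - {x})" and ?Y = "\<Union>(A ` K) \<union> (A i - {y})"
  have finJK: "finite J" "finite K" "finite ?X" "finite ?Y"
    using J(1) K(1) fin i by (auto intro: finite_subset[of _ I])
  have "?X \<union> ?Y = \<Union>(A ` insert i (J \<union> K))" using xy by auto
  moreover have "card (insert i (J \<union> K)) \<le> card (\<Union>(A ` insert i (J \<union> K)))"
    using hall J(1) K(1) i unfolding hall_condition_def by (metis Diff_subset Un_least insert_subset subset_trans)
  moreover have "card (insert i (J \<union> K)) = Suc (card (J \<union> K))"
    using J(1) K(1) finJK by (subst card_insert_disjoint) auto
  moreover have "card (J \<inter> K) \<le> card (?X \<inter> ?Y)"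
  proof -
    have "card (J \<inter> K) \<le> card (\<Union>(A ` (J \<inter> K)))"
      using hall J(1) unfolding hall_condition_def by (metis Diff_subset Int_lower1 subset_trans)
    also have "\<dots> \<le> card (?X \<inter> ?Y)" using finJK by (intro card_mono) auto
    finally show ?thesis .
  qed
  moreover have "card (?X \<union> ?Y) + card (?X \<inter> ?Y) = card ?X + card ?Y"
    using finJK by (metis card_Un_Int)
  moreover have "card (J \<union> K) + card (J \<inter> K) = card J + card K"
    using finJK by (metis card_Un_Int)
  ultimately show False using J(2) K(2) by simp
qed

text \<open>Rado's argument: the sets can be shrunk, preserving Hall's condition, until all are
  singletons.\<close>

theorem hall_marriage:
  assumes "finite I" "\<And>i. i \<in> I \<Longrightarrow> finite (A i)" "hall_condition I A"
  shows "\<exists>R. inj_on R I \<and> (\<forall>i\<in>I. R i \<in> A i)"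
  using assms
proof (induction "\<Sum>i\<in>I. card (A i)" arbitrary: A rule: less_induct)
  case less
  have ge1: "1 \<le> card (A i)" if "i \<in> I" for i
    using less.prems(3) that unfolding hall_condition_def by (auto dest: spec[of _ "{i}"])
  show ?case
  proof (cases "\<exists>i\<in>I. \<exists>x\<in>A i. \<exists>y\<in>A i. x \<noteq> y")
    case True
    then obtain i x y where i: "i \<in> I" and xy: "x \<in> A i" "y \<in> A i" "x \<noteq> y" by blast
    obtain z where z: "z \<in> A i" "hall_condition I (A(i := A i - {z}))"
      using hall_condition_delete[OF less.prems i xy] xy by blast
    let ?B = "A(i := A i - {z})"
    have "(\<Sum>j\<in>I. card (?B j)) < (\<Sum>j\<in>I. card (A j))"
      using less.prems(1,2) i z(1) by (intro sum_strict_mono_ex1) (auto simp: card_Diff1_le card_gt_0_iff intro!: bexI[of _ i] diff_less)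
    moreover have "finite (?B j)" if "j \<in> I" for j using less.prems(2) that by auto
    ultimately obtain R where "inj_on R I" "\<forall>j\<in>I. R j \<in> ?B j"
      using less.hyps[of ?B] less.prems(1) z(2) by blast
    then show ?thesis by (intro exI[of _ R]) (auto split: if_splits)
  next
    case False
    \<comment> \<open>No set has two elements any more, and \<open>ge1\<close> excludes empty ones.
      Injectivity is then Hall's condition for pairs of indices.\<close>
    have "\<exists>x. A i = {x}" if "i \<in> I" for i
      using False ge1[OF that] that by (metis card_eq_0_iff is_singletonI' is_singleton_def not_one_le_zero)
    then obtain R where R: "\<And>i. i \<in> I \<Longrightarrow> A i = {R i}" by metis
    have "inj_on R I"
    proof (rule inj_onI, rule ccontr)
      fix i j assume ij: "i \<in> I" "j \<in> I" "R i = R j" "i \<noteq> j"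
      have "{i, j} \<subseteq> I" using ij(1,2) by simp
      then have "card {i, j} \<le> card (\<Union>(A ` {i, j}))"
        using less.prems(3) unfolding hall_condition_def by blast
      also have "\<Union>(A ` {i, j}) = {R j}" using R[OF ij(1)] R[OF ij(2)] ij(3) by simp
      finally show False using ij(4) by simp
    qed
    then show ?thesis using R by auto
  qed
qed

section \<open>Row submatrices and full column rank\<close>

lemma row_submatrix_carrier:
  assumes "X \<in> carrier_mat m r" "A \<subseteq> {0..<m}"
  shows "row_submatrix X A \<in> carrier_mat (card A) r"
proof -
  have "{i. i < m \<and> i \<in> A} = A" using assms(2) by auto
  then show ?thesis
    using assms(1) unfolding row_submatrix_def by (intro carrier_matI) (simp_all add: dim_submatrix)
qed

lemma row_submatrix_index:
  assumes "X \<in> carrier_mat m r" "A \<subseteq> {0..<m}" "a < card A" "j < r"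
  shows "row_submatrix X A $$ (a, j) = X $$ (pick A a, j)"
proof -
  have "{i. i < m \<and> i \<in> A} = A" using assms(2) by auto
  then show ?thesis using assms unfolding row_submatrix_def
    by (subst submatrix_index) (auto simp: pick_UNIV)
qed

lemma pick_mem_lessThan:
  assumes "A \<subseteq> {0..<m}" "a < card A"
  shows "pick A a \<in> A" "pick A a < m"
  using assms pick_in_set[of a A] by auto

lemma pick_surj:
  assumes "finite A" "i \<in> A"
  obtains a where "a < card A" "pick A a = i"
proof
  \<comment> \<open>The position of \<open>i\<close> in \<open>A\<close>, counted from 0, is the
    number of smaller elements.\<close>
  show "pick A (card {a \<in> A. a < i}) = i" by (rule pick_card_in_set[OF assms(2)])
  show "card {a \<in> A. a < i} < card A" using assms by (intro psubset_card_mono) auto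
qed

text \<open>Signed permutations multiply from the right, so this carries them out of a row
  selection.\<close>

lemma row_submatrix_mult:
  fixes X :: "'a::semiring_0 mat"
  assumes X: "X \<in> carrier_mat m r" and Y: "Y \<in> carrier_mat r c" and A: "A \<subseteq> {0..<m}"
  shows "row_submatrix (X * Y) A = row_submatrix X A * Y"
proof (rule eq_matI)
  have XY: "X * Y \<in> carrier_mat m c" using X Y by simp
  note carr = row_submatrix_carrier[OF X A] row_submatrix_carrier[OF XY A]
  show "dim_row (row_submatrix (X * Y) A) = dim_row (row_submatrix X A * Y)"
    "dim_col (row_submatrix (X * Y) A) = dim_col (row_submatrix X A * Y)"
    using carr Y by auto
  fix a j assume "a < dim_row (row_submatrix X A * Y)" "j < dim_col (row_submatrix X A * Y)"
  then have aj: "a < card A" "j < c" using carr Y by auto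
  have "Matrix.row (row_submatrix X A) a = Matrix.row X (pick A a)"
    using row_submatrix_index[OF X A aj(1)] carr(1) X aj pick_mem_lessThan[OF A aj(1)]
    by (intro eq_vecI) auto
  then show "row_submatrix (X * Y) A $$ (a, j) = (row_submatrix X A * Y) $$ (a, j)"
    using row_submatrix_index[OF XY A aj] aj carr X Y pick_mem_lessThan[OF A aj(1)] by auto
qed

text \<open>The rank is the size of a maximal independent subset of the set of columns, where
  repeated columns count once. Rank \<open>nc\<close> therefore first forces the columns to be
  distinct; only then does a nonzero kernel vector contradict their independence.\<close>

lemma (in vec_space) full_rank_kernel_zero:
  assumes A: "A \<in> carrier_mat n nc" and rank: "rank A = nc"
    and v: "v \<in> carrier_vec nc" "A *\<^sub>v v = 0\<^sub>v n"
  shows "v = 0\<^sub>v nc"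
proof (rule ccontr)
  assume "v \<noteq> 0\<^sub>v nc"
  obtain S where S: "maximal S (\<lambda>T. T \<subseteq> set (cols A) \<and> lin_indpt T)"
    using maximal_exists[of "(\<lambda>T. T \<subseteq> set (cols A) \<and> lin_indpt T)" "card (set (cols A))" "{}"]
    by (meson List.finite_set card_mono empty_iff empty_subsetI finite_lin_indpt2 rev_finite_subset)
  have "nc = card S" using rank_card_indpt[OF A S] rank by simp
  also have "\<dots> \<le> card (set (cols A))" using S unfolding maximal_def by (auto intro: card_mono)
  finally have "distinct (cols A)" using A
    by (intro card_distinct) (use card_length[of "cols A"] in auto)
  then show False
    using full_rank_lin_indpt[OF A rank] lin_depI[OF A v(1) \<open>v \<noteq> 0\<^sub>v nc\<close> v(2)] by blast
qed

text \<open>The coefficient matrix is padded with zero rows to a square matrix \<open>B\<close>.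
  Every Leibniz product meets the zero row \<open>card K\<close>, so \<open>det B = 0\<close>, and a
  kernel vector carried back along the enumeration \<open>h\<close> is the solution.\<close>

lemma underdetermined_system:
  fixes f :: "'i \<Rightarrow> 'j \<Rightarrow> 'a::field"
  assumes fin: "finite K" "finite J" and lt: "card K < card J"
  shows "\<exists>w. (\<exists>j\<in>J. w j \<noteq> 0) \<and> (\<forall>i\<in>K. (\<Sum>j\<in>J. f i j * w j) = 0)"
proof -
  let ?q = "card J"
  obtain h where h: "bij_betw h {0..<?q} J" using ex_bij_betw_nat_finite[OF fin(2)] by blast
  obtain g where g: "bij_betw g {0..<card K} K" using ex_bij_betw_nat_finite[OF fin(1)] by blast
  define B where "B = mat ?q ?q (\<lambda>(a, b). if a < card K then f (g a) (h b) else 0)"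
  have B: "B \<in> carrier_mat ?q ?q" unfolding B_def by simp
  have "(\<Prod>i = 0..<?q. B $$ (i, p i)) = 0" if "p permutes {0..<?q}" for p
  proof (rule prod_zero)
    have "p (card K) < ?q" using permutes_in_image[OF that, of "card K"] lt by simp
    then have "B $$ (card K, p (card K)) = 0" unfolding B_def using lt by simp
    then show "\<exists>i\<in>{0..<?q}. B $$ (i, p i) = 0" using lt by (intro bexI[of _ "card K"]) auto
  qed simp
  then have "det B = 0" unfolding det_def'[OF B] by (intro sum.neutral) auto
  then obtain v where v: "v \<in> carrier_vec ?q" "v \<noteq> 0\<^sub>v ?q" "B *\<^sub>v v = 0\<^sub>v ?q"
    using det_0_iff_vec_prod_zero_field[OF B] by blast
  define w where "w j = v $ (the_inv_into {0..<?q} h j)" for j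
  have w: "w (h b) = v $ b" if "b < ?q" for b
    unfolding w_def using h that by (simp add: bij_betw_def the_inv_into_f_f)
  obtain b where b: "b < ?q" "v $ b \<noteq> 0"
    using v(1,2) by (metis carrier_vecD eq_vecI index_zero_vec)
  have "h b \<in> J" using h b(1) by (auto simp: bij_betw_def)
  moreover have "(\<Sum>j\<in>J. f i j * w j) = 0" if "i \<in> K" for i
  proof -
    have "i \<in> g ` {0..<card K}" using that by (simp only: bij_betw_imp_surj_on[OF g])
    then obtain a where a: "a < card K" "i = g a" 
      unfolding image_iff Bex_def atLeastLessThan_iff by blast
    have "(\<Sum>j\<in>J. f i j * w j) = (\<Sum>b\<in>{0..<?q}. f i (h b) * w (h b))"
      by (rule sum.reindex_bij_betw[OF h, symmetric])
    also have "\<dots> = (B *\<^sub>v v) $ a"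
      using a lt v(1) by (auto simp: B_def scalar_prod_def w intro!: sum.cong)
    finally show ?thesis using a lt v(3) by simp
  qed
  ultimately show ?thesis using b w by metis
qed

text \<open>Otherwise the equations of the rows in \<open>K\<close> have a nonzero solution on
  \<open>J\<close>. Extended by zero it lies in the kernel, since the other rows vanish on
  \<open>J\<close>, and full column rank excludes this.\<close>

lemma full_rank_zero_block:
  fixes A :: "'a::field mat"
  assumes A: "A \<in> carrier_mat n c" and rank: "vec_space.rank n A = c"
    and J: "J \<subseteq> {0..<c}" and K: "K \<subseteq> {0..<n}"
    and zero: "\<And>i j. i < n \<Longrightarrow> i \<notin> K \<Longrightarrow> j \<in> J \<Longrightarrow> A $$ (i, j) = 0"
  shows "card J \<le> card K"
proof (rule ccontr)
  assume "\<not> card J \<le> card K"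
  then have "card K < card J" by simp
  moreover have "finite K" "finite J" using J K finite_subset by blast+
  ultimately obtain w where w: "\<exists>j\<in>J. w j \<noteq> 0" "\<And>i. i \<in> K \<Longrightarrow> (\<Sum>j\<in>J. A $$ (i, j) * w j) = 0"
    using underdetermined_system[of K J "\<lambda>i j. A $$ (i, j)"] by blast
  define v where "v = vec c (\<lambda>j. if j \<in> J then w j else 0)"
  have "A *\<^sub>v v = 0\<^sub>v n"
  proof (rule eq_vecI)
    fix i assume "i < dim_vec (0\<^sub>v n :: 'a vec)"
    then have i: "i < n" by simp
    have "(A *\<^sub>v v) $ i = (\<Sum>j\<in>{0..<c}. if j \<in> J then A $$ (i, j) * w j else 0)"
      using A i by (auto simp: v_def scalar_prod_def intro!: sum.cong)
    also have "\<dots> = (\<Sum>j\<in>J. A $$ (i, j) * w j)"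
      using J by (simp add: sum.If_cases Int_absorb1)
    also have "\<dots> = 0" using w(2) zero[OF i] by (cases "i \<in> K") auto
    finally show "(A *\<^sub>v v) $ i = 0\<^sub>v n $ i" using i by simp
  qed (use A in auto)
  moreover have "v \<in> carrier_vec c" unfolding v_def by simp
  ultimately have "v = 0\<^sub>v c" using vec_space.full_rank_kernel_zero[OF A rank] by blast
  then have "w j = 0" if "j \<in> J" for j
    using J that by (metis (mono_tags, lifting) atLeastLessThan_iff index_vec index_zero_vec(1) subsetD v_def)
  then show False using w(1) by blast
qed

text \<open>In use, \<open>N\<close> contains all nonzero rows of the columns in \<open>J\<close>,
  so every row set of full rank has to spend \<open>card J\<close> rows of \<open>N\<close>.\<close>

lemma row_submatrix_full_rank_zero_block:
  fixes X :: "'a::field mat"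
  assumes X: "X \<in> carrier_mat m r" and A: "A \<subseteq> {0..<m}"
    and rank: "vec_space.rank (card A) (row_submatrix X A) = r"
    and J: "J \<subseteq> {0..<r}"
    and zero: "\<And>i j. i \<in> A \<Longrightarrow> i \<notin> N \<Longrightarrow> j \<in> J \<Longrightarrow> X $$ (i, j) = 0"
  shows "card J \<le> card (A \<inter> N)"
proof -
  let ?K = "{a. a < card A \<and> pick A a \<in> N}"
  have "card J \<le> card ?K"
  proof (rule full_rank_zero_block[OF row_submatrix_carrier[OF X A] rank J])
    fix a j assume "a < card A" "a \<notin> ?K" "j \<in> J"
    moreover from this have "j < r" using J by auto
    ultimately show "row_submatrix X A $$ (a, j) = 0"
      using row_submatrix_index[OF X A] pick_mem_lessThan(1)[OF A] zero by auto
  qed auto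
  also have "\<dots> \<le> card (A \<inter> N)"
  proof (rule card_inj_on_le[of "pick A"])
    show "inj_on (pick A) ?K" 
      by (rule inj_onI) (metis (mono_tags, lifting) linorder_neqE_nat mem_Collect_eq nat_less_le pick_mono_le)
    show "pick A ` ?K \<subseteq> A \<inter> N" using pick_mem_lessThan(1)[OF A] by auto
    show "finite (A \<inter> N)" using A finite_subset by blast
  qed
  finally show ?thesis .
qed

section \<open>Zero sets of separately polynomial functions\<close>

text \<open>Induction on the coordinates with Fubini. Freezing coordinate \<open>i\<close> at
  \<open>x0 i\<close> gives \<open>g\<close>, whose zero set is null by the induction hypothesis.
  Wherever \<open>g y\<close> is nonzero, the slice of \<open>Z\<close> in direction
  \<open>i\<close> is the zero set of a nonzero polynomial, hence finite.\<close>

lemma null_set_separately_polynomial: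
  fixes f :: "('i \<Rightarrow> real) \<Rightarrow> real"
  assumes "finite I" and "f \<in> borel_measurable (\<Pi>\<^sub>M i\<in>I. lborel)"
    and "\<And>x i. x \<in> I \<rightarrow>\<^sub>E UNIV \<Longrightarrow> i \<in> I \<Longrightarrow> \<exists>p. \<forall>t. f (x(i := t)) = poly p t"
    and "x0 \<in> I \<rightarrow>\<^sub>E UNIV" "f x0 \<noteq> 0"
  shows "{x \<in> I \<rightarrow>\<^sub>E UNIV. f x = 0} \<in> null_sets (\<Pi>\<^sub>M i\<in>I. lborel)"
  using assms
proof (induction I arbitrary: f x0 rule: finite_induct)
  case empty
  \<comment> \<open>The empty product has the single point \<open>x0\<close>, where \<open>f\<close>
    does not vanish.\<close>
  have "x = x0" if "x \<in> {} \<rightarrow>\<^sub>E UNIV" for x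
    using that empty.prems(3) by simp
  then have *: "{x \<in> {} \<rightarrow>\<^sub>E UNIV. f x = 0} = {}" using empty.prems(4) by blast
  show ?case unfolding * by (rule null_sets.empty_sets)
next
  case (insert i J)
  interpret product_sigma_finite "\<lambda>_::'i. lborel :: real measure" by standard
  let ?M = "\<lambda>I::'i set. \<Pi>\<^sub>M i\<in>I. (lborel :: real measure)"
  define g where "g y = f (y(i := x0 i))" for y
  define Z where "Z = {x \<in> insert i J \<rightarrow>\<^sub>E UNIV. f x = 0}"
  have Z: "Z = {x \<in> space (?M (insert i J)). f x = 0}"
    unfolding Z_def by (simp add: space_PiM)
  have Zm: "Z \<in> sets (?M (insert i J))" unfolding Z using insert.prems(1) by measurable
  have upd: "(\<lambda>y. y(i := x0 i)) \<in> measurable (?M J) (?M (insert i J))"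
    by (rule measurable_fun_upd[where J=J]) auto
  have g: "g \<in> borel_measurable (?M J)"
    unfolding g_def using measurable_compose[OF upd insert.prems(1)] .
  have upd_in: "y(i := t) \<in> insert i J \<rightarrow>\<^sub>E UNIV" if "y \<in> J \<rightarrow>\<^sub>E UNIV" for y :: "'i \<Rightarrow> real" and t
    using that by (auto simp: PiE_iff extensional_def)
  have "\<exists>p. \<forall>t. g (y(j := t)) = poly p t" if "y \<in> J \<rightarrow>\<^sub>E UNIV" "j \<in> J" for y j
    using insert.prems(2)[OF upd_in[OF that(1), of "x0 i"], of j] insert.hyps(2) that(2)
    unfolding g_def by (metis fun_upd_twist insertI2)
  \<comment> \<open>Points of the product are \<open>undefined\<close> off the index set, so the
    value at \<open>i\<close> is erased; \<open>g\<close> restores it.\<close>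
  moreover have "x0(i := undefined) \<in> J \<rightarrow>\<^sub>E UNIV"
    using insert.prems(3) by (auto simp: PiE_iff extensional_def)
  moreover have "g (x0(i := undefined)) \<noteq> 0" unfolding g_def using insert.prems(4) by simp
  ultimately have "{y \<in> J \<rightarrow>\<^sub>E UNIV. g y = 0} \<in> null_sets (?M J)"
    using insert.IH g by blast
  then have AE: "AE y in ?M J. g y \<noteq> 0"
    by (rule AE_I') (auto simp: space_PiM)
  have "emeasure (?M (insert i J)) Z = (\<integral>\<^sup>+x. indicator Z x \<partial>?M (insert i J))"
    using Zm by simp
  also have "\<dots> = (\<integral>\<^sup>+y. (\<integral>\<^sup>+t. indicator Z (y(i := t)) \<partial>lborel) \<partial>?M J)"
    using insert.hyps Zm by (intro product_nn_integral_insert) auto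
  also have "\<dots> = (\<integral>\<^sup>+y. 0 \<partial>?M J)"
  proof (rule nn_integral_cong_AE, use AE AE_space in eventually_elim)
    case (elim y)
    then have y: "y \<in> J \<rightarrow>\<^sub>E UNIV" by (simp add: space_PiM)
    obtain p where p: "\<And>t. f (y(i := t)) = poly p t"
      using insert.prems(2)[OF upd_in[OF y, of 0], of i] unfolding fun_upd_upd by blast
    \<comment> \<open>At \<open>x0 i\<close> the polynomial takes the value
      \<open>g y\<close>.\<close>
    have "p \<noteq> 0" using elim p unfolding g_def by auto
    then have fin: "finite {t. poly p t = 0}" by (rule poly_roots_finite)
    have "indicator Z (y(i := t)) = (indicator {t. poly p t = 0} t :: ennreal)" for t
      using p upd_in[OF y] unfolding Z_def by (auto simp: indicator_def)
    then have "(\<integral>\<^sup>+t. indicator Z (y(i := t)) \<partial>lborel) = emeasure lborel {t. poly p t = 0}"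
      using fin by (simp add: borel_closed finite_imp_closed)
    also have "\<dots> = 0" using fin by (simp add: finite_imp_null_set_lborel null_setsD1)
    finally show "(\<integral>\<^sup>+t. indicator Z (y(i := t)) \<partial>lborel) = 0" .
  qed
  finally show ?case using Zm unfolding Z_def by (simp add: null_setsI)
qed

section \<open>Determinants of matrices with generic entries\<close>

lemma finite_support: "finite (support \<delta>)"
  by (rule finite_subset[of _ "{..<dim_row \<delta>} \<times> {..<dim_col \<delta>}"]) (auto simp: support_def)

lemma matrix_of_entries_carrier:
  "\<delta> \<in> carrier_mat m r \<Longrightarrow> matrix_of_entries \<delta> x \<in> carrier_mat m r"
  unfolding matrix_of_entries_def by simp

lemma minor_measurable:
  assumes \<delta>: "\<delta> \<in> carrier_mat m r" and A: "A \<subseteq> {0..<m}" "card A = r"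
  shows "(\<lambda>x. det (row_submatrix (matrix_of_entries \<delta> x) A))
    \<in> borel_measurable (\<Pi>\<^sub>M ij \<in> support \<delta>. lborel)"
proof -
  have "(\<lambda>x. row_submatrix (matrix_of_entries \<delta> x) A $$ (a, j))
      \<in> borel_measurable (\<Pi>\<^sub>M ij \<in> support \<delta>. lborel)" if "a < r" "j < r" for a j
  proof -
    have "row_submatrix (matrix_of_entries \<delta> x) A $$ (a, j) =
        (if (pick A a, j) \<in> support \<delta> then x (pick A a, j) else 0)" for x
      using row_submatrix_index[OF matrix_of_entries_carrier[OF \<delta>] A(1), of a j x] that A
        pick_mem_lessThan(2)[OF A(1), of a] \<delta>
      by (simp add: matrix_of_entries_def)
    then show ?thesis
      using measurable_component_singleton[of "(pick A a, j)" "support \<delta>" "\<lambda>_. lborel :: real measure"]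
      by (cases "(pick A a, j) \<in> support \<delta>") (simp_all cong: measurable_cong_sets)
  qed
  moreover have "row_submatrix (matrix_of_entries \<delta> x) A \<in> carrier_mat r r" for x
    using row_submatrix_carrier[OF matrix_of_entries_carrier[OF \<delta>] A(1)] A(2) by simp
  ultimately show ?thesis
    by (subst det_def') (auto intro!: borel_measurable_sum borel_measurable_times borel_measurable_prod
        dest: permutes_in_image)
qed

text \<open>The entry at \<open>ij\<close> becomes the indeterminate and the others become constant
  polynomials. Evaluation at \<open>t\<close> is a ring homomorphism and so commutes with
  \<open>det\<close>.\<close>

lemma minor_separately_polynomial:
  assumes \<delta>: "\<delta> \<in> carrier_mat m r" and A: "A \<subseteq> {0..<m}" "card A = r"
  shows "\<exists>p. \<forall>t. det (row_submatrix (matrix_of_entries \<delta> (x(ij := t))) A) = poly p t"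
proof -
  define B where "B = mat r r (\<lambda>(a, j). if (pick A a, j) \<in> support \<delta>
      then if (pick A a, j) = ij then [:0, 1:] else [:x (pick A a, j):] else 0)"
  have "row_submatrix (matrix_of_entries \<delta> (x(ij := t))) A = map_mat (\<lambda>p. poly p t) B" for t
  proof (rule eq_matI)
    note carr = row_submatrix_carrier[OF matrix_of_entries_carrier[OF \<delta>] A(1), of "x(ij := t)"]
    show "dim_row (row_submatrix (matrix_of_entries \<delta> (x(ij := t))) A) = dim_row (map_mat (\<lambda>p. poly p t) B)"
      "dim_col (row_submatrix (matrix_of_entries \<delta> (x(ij := t))) A) = dim_col (map_mat (\<lambda>p. poly p t) B)"
      using carr A(2) by (simp_all add: B_def)
    fix a j assume "a < dim_row (map_mat (\<lambda>p. poly p t) B)" "j < dim_col (map_mat (\<lambda>p. poly p t) B)"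
    then have "a < r" "j < r" by (simp_all add: B_def)
    then show "row_submatrix (matrix_of_entries \<delta> (x(ij := t))) A $$ (a, j) = map_mat (\<lambda>p. poly p t) B $$ (a, j)"
      using row_submatrix_index[OF matrix_of_entries_carrier[OF \<delta>] A(1), of a j "x(ij := t)"] A
        pick_mem_lessThan(2)[OF A(1), of a] \<delta>
      by (simp add: matrix_of_entries_def B_def)
  qed
  moreover have "det (map_mat (\<lambda>p. poly p t) B) = poly (det B) t" for t
  proof -
    interpret comm_ring_hom "\<lambda>p. poly p t" by unfold_locales auto
    show ?thesis by (rule hom_det)
  qed
  ultimately show ?thesis by auto
qed

text \<open>At the indicator of a matching, the selected row \<open>f j\<close> is the unit vector
  at column \<open>j\<close>, so a kernel vector vanishes in every coordinate.\<close>

lemma minor_matching_nonzero: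
  assumes \<delta>: "\<delta> \<in> carrier_mat m r"
    and f: "inj_on f {0..<r}" "\<And>j. j < r \<Longrightarrow> (f j, j) \<in> support \<delta>"
  shows "det (row_submatrix (matrix_of_entries \<delta> (\<lambda>(i, j). if i = f j then 1 else 0)) (f ` {0..<r})) \<noteq> 0"
    (is "det ?S \<noteq> 0")
proof
  let ?A = "f ` {0..<r}" and ?X = "matrix_of_entries \<delta> (\<lambda>(i, j). if i = f j then 1 else 0)"
  have A: "?A \<subseteq> {0..<m}" "card ?A = r"
    using f \<delta> by (auto simp: support_def card_image)
  note X = matrix_of_entries_carrier[OF \<delta>]
  have S: "?S \<in> carrier_mat r r" using row_submatrix_carrier[OF X A(1)] A(2) by simp
  assume "det ?S = 0"
  then obtain v where v: "v \<in> carrier_vec r" "v \<noteq> 0\<^sub>v r" "?S *\<^sub>v v = 0\<^sub>v r"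
    using det_0_iff_vec_prod_zero_field[OF S] by blast
  have "v $ j = 0" if j: "j < r" for j
  proof -
    obtain a where a: "a < card ?A" "pick ?A a = f j"
      by (rule pick_surj[of ?A "f j"]) (use j in auto)
    have entry: "?S $$ (a, k) = (if k = j then 1 else 0)" if "k < r" for k
    proof -
      have "?S $$ (a, k) = ?X $$ (f j, k)"
        using row_submatrix_index[OF X A(1) a(1) that] a(2) by simp
      also have "\<dots> = (if k = j then 1 else 0)"
        using f that j \<delta> unfolding matrix_of_entries_def
        by (auto simp: support_def inj_on_eq_iff[OF f(1)])
      finally show ?thesis .
    qed
    have "(?S *\<^sub>v v) $ a = (\<Sum>k\<in>{0..<r}. ?S $$ (a, k) * v $ k)"
      using S a(1) A(2) v(1) by (auto simp: scalar_prod_def intro!: sum.cong)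
    also have "\<dots> = (\<Sum>k\<in>{0..<r}. if k = j then v $ k else 0)"
      by (intro sum.cong) (auto simp: entry)
    also have "\<dots> = v $ j" using j by simp
    finally show ?thesis using v(3) a(1) A(2) by simp
  qed
  then have "v = 0\<^sub>v r" using v(1) by (intro eq_vecI) auto
  then show False using v(2) by simp
qed

lemma singular_matching_minor_null:
  assumes \<delta>: "\<delta> \<in> carrier_mat m r"
    and f: "inj_on f {0..<r}" "\<And>j. j < r \<Longrightarrow> (f j, j) \<in> support \<delta>"
  shows "{x \<in> support \<delta> \<rightarrow>\<^sub>E UNIV. det (row_submatrix (matrix_of_entries \<delta> x) (f ` {0..<r})) = 0}
    \<in> null_sets (\<Pi>\<^sub>M ij \<in> support \<delta>. lborel)"
proof -
  have A: "f ` {0..<r} \<subseteq> {0..<m}" "card (f ` {0..<r}) = r"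
    using f \<delta> by (auto simp: support_def card_image)
  \<comment> \<open>The restriction makes the indicator a point of the product space;
    \<open>matrix_of_entries\<close> reads no value off the support, so the minor is
    unchanged.\<close>
  define x0 where "x0 = restrict (\<lambda>(i, j). if i = f j then 1 else (0 :: real)) (support \<delta>)"
  have "matrix_of_entries \<delta> x0 = matrix_of_entries \<delta> (\<lambda>(i, j). if i = f j then 1 else 0)"
    unfolding matrix_of_entries_def x0_def by (intro cong_mat) auto
  then have "det (row_submatrix (matrix_of_entries \<delta> x0) (f ` {0..<r})) \<noteq> 0"
    using minor_matching_nonzero[OF \<delta> f] by simp
  moreover have "x0 \<in> support \<delta> \<rightarrow>\<^sub>E UNIV" unfolding x0_def by simp
  ultimately show ?thesis
    by (intro null_set_separately_polynomial[OF finite_support minor_measurable[OF \<delta> A]]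
        minor_separately_polynomial[OF \<delta> A])
qed

section \<open>The counting rule and matchings\<close>

text \<open>Turns the row count of the counting rule into a neighbourhood in the bipartite graph
  \<open>support \<delta>\<close> between rows and columns, as Hall's theorem requires.\<close>

lemma nonzero_rows_col_submatrix:
  fixes \<delta> :: "nat mat"
  assumes \<delta>: "\<delta> \<in> carrier_mat m r" and J: "J \<subseteq> {0..<r}"
  shows "nonzero_rows (col_submatrix \<delta> J) = {i. \<exists>j\<in>J. (i, j) \<in> support \<delta>}"
proof (rule Set.set_eqI)
  fix i
  have J': "{j. j < r \<and> j \<in> J} = J" using J by auto
  have carr: "col_submatrix \<delta> J \<in> carrier_mat m (card J)"
    using \<delta> J' unfolding col_submatrix_def by (intro carrier_matI) (simp_all add: dim_submatrix)
  have entry: "col_submatrix \<delta> J $$ (i, b) = \<delta> $$ (i, pick J b)" if "i < m" "b < card J" for b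
    using that \<delta> J' unfolding col_submatrix_def by (subst submatrix_index) (auto simp: pick_UNIV)
  have "i \<in> nonzero_rows (col_submatrix \<delta> J) \<longleftrightarrow>
      i < m \<and> (\<exists>b<card J. col_submatrix \<delta> J $$ (i, b) \<noteq> 0)"
    using carr unfolding nonzero_rows_def by (auto simp: vec_eq_iff)
  also have "\<dots> \<longleftrightarrow> i < m \<and> (\<exists>b<card J. \<delta> $$ (i, pick J b) \<noteq> 0)" using entry by auto
  also have "\<dots> \<longleftrightarrow> i < m \<and> (\<exists>j\<in>J. \<delta> $$ (i, j) \<noteq> 0)"
    using pick_mem_lessThan(1)[OF J] pick_surj[OF finite_subset[OF J finite_atLeastLessThan]]
    by metis
  also have "\<dots> \<longleftrightarrow> i \<in> {i. \<exists>j\<in>J. (i, j) \<in> support \<delta>}"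
    using \<delta> J by (force simp: support_def)
  finally show "i \<in> nonzero_rows (col_submatrix \<delta> J) \<longleftrightarrow> i \<in> {i. \<exists>j\<in>J. (i, j) \<in> support \<delta>}" .
qed

text \<open>Hall's theorem is applied to two copies \<open>(j, False)\<close>, \<open>(j, True)\<close> of every column.\<close>

lemma CR_two_disjoint_matchings:
  assumes \<delta>: "\<delta> \<in> carrier_mat m r" and CR: "CR s \<delta>" and D: "finite D" "card D = s"
  obtains f g where "inj_on f {0..<r}" "inj_on g {0..<r}"
    "\<And>j. j < r \<Longrightarrow> (f j, j) \<in> support \<delta>" "\<And>j. j < r \<Longrightarrow> (g j, j) \<in> support \<delta>"
    "f ` {0..<r} \<inter> g ` {0..<r} = {}" "(f ` {0..<r} \<union> g ` {0..<r}) \<inter> D = {}"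
proof -
  define nb where "nb = (\<lambda>(j, b :: bool). {i. (i, j) \<in> support \<delta>} - D)"
  let ?I = "{0..<r} \<times> (UNIV :: bool set)"
  have fin: "finite {i. (i, j) \<in> support \<delta>}" for j
    by (rule finite_subset[of _ "fst ` support \<delta>"]) (force intro: finite_support)+
  have "hall_condition ?I nb"
    unfolding hall_condition_def
  proof (intro allI impI)
    fix S assume S: "S \<subseteq> ?I"
    define J where "J = fst ` S"
    have J: "J \<subseteq> {0..<r}" using S unfolding J_def by auto
    then have finJ: "finite J" using finite_subset by blast
    \<comment> \<open>The two copies of each column account for the factor 2 in the counting rule;
      the deletion of \<open>D\<close> will use up the summand \<open>s\<close>.\<close>
    have "card S \<le> card (J \<times> (UNIV :: bool set))"
      using S finJ by (intro card_mono) (auto simp: J_def intro: rev_image_eqI)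
    then have S2: "card S \<le> 2 * card J" by (simp add: card_cartesian_product)
    show "card S \<le> card (\<Union>(nb ` S))"
    \<comment> \<open>The counting rule speaks only about \<open>q \<ge> 1\<close>.\<close>
    proof (cases "J = {}")
      case True
      then show ?thesis using S2 by simp
    next
      case False
      let ?N = "nonzero_rows (col_submatrix \<delta> J)"
      have "1 \<le> card J" using False finJ by (simp add: Suc_le_eq card_gt_0_iff)
      moreover have "card J \<le> r" using card_mono[OF _ J] by simp
      ultimately have "2 * card J + s \<le> card ?N" using CR J \<delta> unfolding CR_def by auto
      moreover have "card ?N - card D \<le> card (?N - D)" by (rule diff_card_le_card_Diff[OF D(1)])
      moreover have "\<Union>(nb ` S) = ?N - D"
        unfolding nonzero_rows_col_submatrix[OF \<delta> J] by (force simp: nb_def J_def)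
      ultimately show ?thesis using S2 D(2) by simp
    qed
  qed
  moreover have "finite (nb i)" for i using fin by (auto simp: nb_def split: prod.splits)
  ultimately obtain R where R: "inj_on R ?I" "\<And>j b. j < r \<Longrightarrow> R (j, b) \<in> nb (j, b)"
    using hall_marriage[of ?I nb] by auto
  \<comment> \<open>Within one copy, injectivity of \<open>R\<close> makes each matching injective;
    across the copies it makes their row sets disjoint.\<close>
  have Req: "R (j, b) = R (k, c) \<longleftrightarrow> j = k \<and> b = c" if "j < r" "k < r" for j k b c
    using inj_on_eq_iff[OF R(1), of "(j, b)" "(k, c)"] that by simp
  show thesis
  proof
    show "inj_on (\<lambda>j. R (j, False)) {0..<r}" "inj_on (\<lambda>j. R (j, True)) {0..<r}"
      by (auto simp: inj_on_def Req)
    show "(\<lambda>j. R (j, False)) ` {0..<r} \<inter> (\<lambda>j. R (j, True)) ` {0..<r} = {}"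
      by (auto simp: Req)
    show "((\<lambda>j. R (j, False)) ` {0..<r} \<union> (\<lambda>j. R (j, True)) ` {0..<r}) \<inter> D = {}"
      using R(2) by (fastforce simp: nb_def)
    show "(R (j, False), j) \<in> support \<delta>" "(R (j, True), j) \<in> support \<delta>" if "j < r" for j
      using R(2)[OF that] by (auto simp: nb_def)
  qed
qed

text \<open>\<open>RD\<close> demands this inequality outright. A single column already has at least
  \<open>2 + s\<close> nonzero rows; for \<open>r = 0\<close> the counting rule would be
  vacuous.\<close>

lemma CR_imp_le_dim_row:
  assumes \<delta>: "\<delta> \<in> carrier_mat m r" and "1 \<le> r" and CR: "CR s \<delta>"
  shows "s \<le> m"
proof -
  have "1 \<in> {1..dim_col \<delta>}" "{0} \<subseteq> {0..<dim_col \<delta>} \<and> card {0 :: nat} = 1"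
    using \<delta> \<open>1 \<le> r\<close> by simp_all
  then have "2 * 1 + s \<le> card (nonzero_rows (col_submatrix \<delta> {0}))"
    using CR unfolding CR_def by blast
  moreover have "nonzero_rows (col_submatrix \<delta> {0}) \<subseteq> {0..<m}"
    using \<delta> unfolding nonzero_rows_def col_submatrix_def by (auto simp: dim_submatrix)
  then have "card (nonzero_rows (col_submatrix \<delta> {0})) \<le> card {0..<m}"
    by (intro card_mono) simp_all
  ultimately show ?thesis by simp
qed

section \<open>Signed permutations\<close>

lemma signed_permutation_entry:
  assumes X: "X \<in> carrier_mat m r" and P: "sign_mat r P" and \<rho>: "\<rho> permutes {0..<r}"
    and ij: "i < m" "j < r"
  shows "(X * P * mat r r (\<lambda>(i, j). if i = \<rho> j then 1 else 0)) $$ (i, j) =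
    X $$ (i, \<rho> j) * P $$ (\<rho> j, \<rho> j)"
proof -
  have Pc: "P \<in> carrier_mat r r" and diag: "\<And>k l. k < r \<Longrightarrow> l < r \<Longrightarrow> k \<noteq> l \<Longrightarrow> P $$ (k, l) = 0"
    using P unfolding sign_mat_def diagonal_mat_def by auto
  have \<rho>j: "\<rho> j < r" using permutes_in_image[OF \<rho>, of j] ij by simp
  have XP: "(X * P) $$ (i, l) = X $$ (i, l) * P $$ (l, l)" if "l < r" for l
  proof -
    have "(X * P) $$ (i, l) = (\<Sum>k\<in>{0..<r}. X $$ (i, k) * P $$ (k, l))"
      using X Pc ij that by (auto simp: scalar_prod_def intro!: sum.cong)
    also have "\<dots> = (\<Sum>k\<in>{0..<r}. if k = l then X $$ (i, k) * P $$ (k, l) else 0)"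
      using diag that by (intro sum.cong) auto
    also have "\<dots> = X $$ (i, l) * P $$ (l, l)" using that by simp
    finally show ?thesis .
  qed
  have "(X * P * mat r r (\<lambda>(i, j). if i = \<rho> j then 1 else 0)) $$ (i, j) =
      (\<Sum>l\<in>{0..<r}. (X * P) $$ (i, l) * (if l = \<rho> j then 1 else 0))"
    using X Pc ij by (simp add: scalar_prod_def)
  also have "\<dots> = (\<Sum>l\<in>{0..<r}. if l = \<rho> j then (X * P) $$ (i, l) else 0)"
    by (intro sum.cong) auto
  also have "\<dots> = (X * P) $$ (i, \<rho> j)" using \<rho>j by simp
  finally show ?thesis using XP[OF \<rho>j] by simp
qed

lemma sign_mat_det_nonzero:
  assumes "sign_mat r P"
  shows "det P \<noteq> 0"
proof -
  have P: "P \<in> carrier_mat r r" "diagonal_mat P" "\<And>i. i < r \<Longrightarrow> P $$ (i, i) \<noteq> 0"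
    using assms unfolding sign_mat_def by force+
  then have "upper_triangular P" by (auto simp: diagonal_mat_def upper_triangular_def)
  then have "det P = prod_list (diag_mat P)" using det_upper_triangular P(1) by blast
  moreover have "0 \<notin> set (diag_mat P)" using P(1,3) by (auto simp: diag_mat_def)
  ultimately show ?thesis by (simp add: prod_list_zero_iff)
qed

text \<open>The transpose sends \<open>v\<close> to the vector with coordinates
  \<open>v $ (\<rho> j)\<close>; as \<open>\<rho>\<close> is onto, its kernel is zero.\<close>

lemma permutation_mat_det_nonzero:
  assumes "permutation_mat r R"
  shows "det R \<noteq> 0"
proof
  assume "det R = 0"
  obtain \<rho> where \<rho>: "\<rho> permutes {0..<r}" and R: "R = mat r r (\<lambda>(i, j). if i = \<rho> j then 1 else 0)"
    using assms unfolding permutation_mat_def by blast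
  have "R\<^sup>T \<in> carrier_mat r r" "det R\<^sup>T = 0"
    using \<open>det R = 0\<close> det_transpose[of R r] by (simp_all add: R)
  then obtain v where v: "v \<in> carrier_vec r" "v \<noteq> 0\<^sub>v r" "R\<^sup>T *\<^sub>v v = 0\<^sub>v r"
    using det_0_iff_vec_prod_zero_field by blast
  have "v $ i = 0" if "i < r" for i
  proof -
    obtain j where j: "j < r" "\<rho> j = i"
    proof
      show "\<rho> (inv_into UNIV \<rho> i) = i" by (rule permutes_inverses(1)[OF \<rho>])
      show "inv_into UNIV \<rho> i < r" using permutes_in_image[OF permutes_inv[OF \<rho>], of i] \<open>i < r\<close> by simp
    qed
    have "(R\<^sup>T *\<^sub>v v) $ j = (\<Sum>k\<in>{0..<r}. (if k = i then 1 else 0) * v $ k)"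
      using j v(1) by (auto simp: R scalar_prod_def intro!: sum.cong)
    also have "\<dots> = (\<Sum>k\<in>{0..<r}. if k = i then v $ k else 0)" by (intro sum.cong) auto
    finally show ?thesis using that j v(3) by simp
  qed
  then have "v = 0\<^sub>v r" using v(1) by (intro eq_vecI) auto
  then show False using v(2) by simp
qed

section \<open>Counting rule and row deletion\<close>

lemma not_CR_imp_not_RD:
  assumes \<delta>: "\<delta> \<in> carrier_mat m r" and CR: "\<not> CR s \<delta>" and \<beta>: "\<beta> \<in> Theta \<delta>"
  shows "\<not> RD s \<beta>"
proof
  assume RD: "RD s \<beta>"
  obtain \<beta>0 P \<rho> where \<beta>0: "sparsity_mat \<beta>0 = \<delta>" and P: "sign_mat r P" and \<rho>: "\<rho> permutes {0..<r}"
    and \<beta>_eq: "\<beta> = \<beta>0 * P * mat r r (\<lambda>(i, j). if i = \<rho> j then 1 else 0)"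
    using \<beta> \<delta> unfolding Theta_def GLT_matrices_def permutation_mat_def by auto
  have \<beta>0c: "\<beta>0 \<in> carrier_mat m r" using \<beta>0 \<delta> unfolding sparsity_mat_def by auto
  have \<beta>c: "\<beta> \<in> carrier_mat m r" unfolding \<beta>_eq using \<beta>0c P by (auto simp: sign_mat_def)
  obtain J where J: "J \<subseteq> {0..<r}" "card (nonzero_rows (col_submatrix \<delta> J)) < 2 * card J + s"
    and J_pos: "1 \<le> card J"
    using CR \<delta> unfolding CR_def by (auto simp: not_le)
  define N where "N = nonzero_rows (col_submatrix \<delta> J)"
  have N_eq: "N = {i. \<exists>j\<in>J. (i, j) \<in> support \<delta>}"
    unfolding N_def by (rule nonzero_rows_col_submatrix[OF \<delta> J(1)])
  have N: "N \<subseteq> {0..<m}" unfolding N_eq using \<delta> by (auto simp: support_def)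
  have finN: "finite N" using N finite_subset by blast
  \<comment> \<open>Column \<open>j\<close> of \<open>\<beta>\<close> is, up to sign, column
    \<open>\<rho> j\<close> of \<open>\<beta>0\<close>, so the deficient columns of
    \<open>\<delta>\<close> are pulled back along \<open>\<rho>\<close>.\<close>
  define J' where "J' = {j. \<rho> j \<in> J}"
  have J': "J' \<subseteq> {0..<r}" using J(1) permutes_in_image[OF \<rho>] unfolding J'_def by blast
  have "\<rho> ` J' = J" unfolding J'_def using permutes_surj[OF \<rho>] by (metis surj_image_vimage_eq vimage_def)
  then have cJ': "card J' = card J"
    using card_image[of \<rho> J'] permutes_inj_on[OF \<rho>] by metis
  have zero: "\<beta> $$ (i, j) = 0" if "i < m" "i \<notin> N" "j \<in> J'" for i j
  proof -
    have "j < r" "\<rho> j \<in> J" "\<rho> j < r" using that J' J(1) unfolding J'_def by auto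
    then have "\<delta> $$ (i, \<rho> j) = 0" using that \<delta> unfolding N_eq support_def by auto
    then have "\<beta>0 $$ (i, \<rho> j) = 0"
      using \<beta>0 \<beta>0c that(1) \<open>\<rho> j < r\<close> unfolding sparsity_mat_def by (auto split: if_splits)
    then show ?thesis
      unfolding \<beta>_eq using signed_permutation_entry[OF \<beta>0c P \<rho> that(1) \<open>j < r\<close>] by simp
  qed
  have sm: "s \<le> m" using RD \<beta>c unfolding RD_def by auto
  \<comment> \<open>The deletions are spent on \<open>N\<close>. If \<open>N\<close> has fewer than
    \<open>s\<close> rows, all of it is deleted and \<open>D\<close> is filled up with other rows,
    which is possible because \<open>s \<le> m\<close>.\<close>
  have "\<exists>D. D \<subseteq> {0..<m} \<and> card D = s \<and> (card (N - D) < 2 * card J \<or> N \<subseteq> D)"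
  proof (cases "s \<le> card N")
    case True
    then obtain D where D: "D \<subseteq> N" "card D = s" using obtain_subset_with_card_n by metis
    then have "card (N - D) = card N - s" using finN by (metis card_Diff_subset finite_subset)
    then show ?thesis using D N J(2) True N_def by (intro exI[of _ D]) auto
  next
    case False
    then show ?thesis using exists_subset_between[of N s "{0..<m}"] N sm by auto
  qed
  then obtain D where D: "D \<subseteq> {0..<m}" "card D = s"
    and ND: "card (N - D) < 2 * card J \<or> N \<subseteq> D" by blast
  then obtain A B where AB: "A \<subseteq> {0..<m} - D" "B \<subseteq> {0..<m} - D" "A \<inter> B = {}"
    and rank: "vec_space.rank (card A) (row_submatrix \<beta> A) = r"
      "vec_space.rank (card B) (row_submatrix \<beta> B) = r"
    using RD \<beta>c unfolding RD_def by (metis carrier_matD)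
  have sub: "A \<subseteq> {0..<m}" "B \<subseteq> {0..<m}" using AB by auto
  have "card J \<le> card (A \<inter> N)"
    unfolding cJ'[symmetric]
    by (rule row_submatrix_full_rank_zero_block[OF \<beta>c sub(1) rank(1) J']) (use zero sub(1) in force)
  moreover have "card J \<le> card (B \<inter> N)"
    unfolding cJ'[symmetric]
    by (rule row_submatrix_full_rank_zero_block[OF \<beta>c sub(2) rank(2) J']) (use zero sub(2) in force)
  moreover have "card (A \<inter> N) + card (B \<inter> N) = card ((A \<inter> N) \<union> (B \<inter> N))"
    using finN AB(3) by (subst card_Un_disjoint) auto
  moreover have "card ((A \<inter> N) \<union> (B \<inter> N)) \<le> card (N - D)"
    using finN AB(1,2) by (intro card_mono) auto
  ultimately have le: "2 * card J \<le> card (N - D)" by simp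
  \<comment> \<open>The bound \<open>le\<close> excludes the first alternative of \<open>ND\<close>.
    In the second, \<open>N - D\<close> is empty although \<open>J\<close> is not.\<close>
  with ND have "N - D = {}" by auto
  with le J_pos show False by simp
qed

text \<open>Right multiplication by \<open>P\<close> and \<open>R\<close> multiplies each maximal
  minor by the nonzero factor \<open>det P * det R\<close>. Hence nonzero minors of \<open>X\<close>
  itself suffice, a condition that does not involve the signed permutation.\<close>

lemma RD_signed_permutation:
  assumes X: "X \<in> carrier_mat m r" and P: "sign_mat r P" and R: "permutation_mat r R" and "s \<le> m"
    and minors: "\<And>D. D \<subseteq> {0..<m} \<Longrightarrow> card D = s \<Longrightarrow> \<exists>A B. A \<subseteq> {0..<m} - D \<and> B \<subseteq> {0..<m} - D \<and>
      A \<inter> B = {} \<and> card A = r \<and> card B = r \<and> det (row_submatrix X A) \<noteq> 0 \<and> det (row_submatrix X B) \<noteq> 0"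
  shows "RD s (X * P * R)"
proof -
  have Pc: "P \<in> carrier_mat r r" using P unfolding sign_mat_def by simp
  have Rc: "R \<in> carrier_mat r r" using R unfolding permutation_mat_def by auto
  have rank: "vec_space.rank (card A) (row_submatrix (X * P * R) A) = r"
    if A: "A \<subseteq> {0..<m}" "card A = r" "det (row_submatrix X A) \<noteq> 0" for A
  proof -
    have S: "row_submatrix X A \<in> carrier_mat r r" using row_submatrix_carrier[OF X A(1)] A(2) by simp
    have XP: "X * P \<in> carrier_mat m r" using X Pc by simp
    have "row_submatrix (X * P * R) A = row_submatrix X A * P * R"
      using row_submatrix_mult[OF XP Rc A(1)] row_submatrix_mult[OF X Pc A(1)] by simp
    moreover have "det (row_submatrix X A * P * R) \<noteq> 0"
      using det_mult[OF mult_carrier_mat[OF S Pc] Rc] det_mult[OF S Pc] A(3)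
        sign_mat_det_nonzero[OF P] permutation_mat_det_nonzero[OF R] by simp
    moreover have "row_submatrix X A * P * R \<in> carrier_mat r r" using S Pc Rc by simp
    ultimately show ?thesis using vec_space.det_rank_iff A(2) by metis
  qed
  have dims: "dim_row (X * P * R) = m" "dim_col (X * P * R) = r" using X Rc by auto
  show ?thesis
    unfolding RD_def dims
  proof (intro conjI allI impI)
    fix D assume "D \<subseteq> {0..<m} \<and> card D = s"
    then obtain A B where AB: "A \<subseteq> {0..<m} - D" "B \<subseteq> {0..<m} - D" "A \<inter> B = {}"
      "card A = r" "card B = r" "det (row_submatrix X A) \<noteq> 0" "det (row_submatrix X B) \<noteq> 0"
      using minors by metis
    then have "A \<subseteq> {0..<m}" "B \<subseteq> {0..<m}" by auto
    with AB show "\<exists>A B. A \<subseteq> {0..<m} - D \<and> B \<subseteq> {0..<m} - D \<and> A \<inter> B = {} \<and>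
        vec_space.rank (card A) (row_submatrix (X * P * R) A) = r \<and>
        vec_space.rank (card B) (row_submatrix (X * P * R) B) = r"
      using rank by (intro exI[of _ A] exI[of _ B]) auto
  qed (rule \<open>s \<le> m\<close>)
qed

text \<open>The exceptional set consists of all violations. In every chart it lies in
  \<open>E\<close>, the finite union over the deletions of the zero sets of two minors, each
  selected by a matching.\<close>

lemma CR_imp_RD_almost_everywhere:
  assumes \<delta>: "\<delta> \<in> carrier_mat m r" and r: "1 \<le> r" and CR: "CR s \<delta>"
  shows "measure_zero_in_Theta \<delta> {\<beta> \<in> Theta \<delta>. \<not> RD s \<beta>}"
  unfolding measure_zero_in_Theta_def
proof (intro conjI allI impI)
  fix P R assume "sign_mat (dim_col \<delta>) P \<and> permutation_mat (dim_col \<delta>) R"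
  then have PR: "sign_mat r P" "permutation_mat r R" using \<delta> by auto
  define DD where "DD = {D. D \<subseteq> {0..<m} \<and> card D = s}"
  let ?sing = "\<lambda>h. {x \<in> support \<delta> \<rightarrow>\<^sub>E UNIV. det (row_submatrix (matrix_of_entries \<delta> x) (h ` {0..<r})) = 0}"
  define matchings where "matchings D f g \<longleftrightarrow> inj_on f {0..<r} \<and> inj_on g {0..<r} \<and>
      (\<forall>j<r. (f j, j) \<in> support \<delta>) \<and> (\<forall>j<r. (g j, j) \<in> support \<delta>) \<and>
      f ` {0..<r} \<inter> g ` {0..<r} = {} \<and> (f ` {0..<r} \<union> g ` {0..<r}) \<inter> D = {}" for D f g
  have "\<exists>f g. matchings D f g" if "D \<in> DD" for D
  proof -
    have D: "finite D" "card D = s" using that unfolding DD_def using finite_subset by auto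
    show ?thesis
      unfolding matchings_def by (rule CR_two_disjoint_matchings[OF \<delta> CR D]) blast
  qed
  then obtain F G where FG: "\<And>D. D \<in> DD \<Longrightarrow> matchings D (F D) (G D)" by metis
  note FG = FG[unfolded matchings_def]
  define E where "E = (\<Union>D\<in>DD. ?sing (F D) \<union> ?sing (G D))"
  have "finite DD" unfolding DD_def by simp
  moreover have "?sing (F D) \<in> null_sets (\<Pi>\<^sub>M ij \<in> support \<delta>. lborel)"
    "?sing (G D) \<in> null_sets (\<Pi>\<^sub>M ij \<in> support \<delta>. lborel)" if "D \<in> DD" for D
    using FG[OF that] by (intro singular_matching_minor_null[OF \<delta>]; blast)+
  ultimately have E: "E \<in> null_sets (\<Pi>\<^sub>M ij \<in> support \<delta>. lborel)"
    unfolding E_def by (intro null_sets_UN' null_sets.Un) (auto intro: countable_finite)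
  have RD: "RD s (matrix_of_entries \<delta> x * P * R)" if x: "x \<in> support \<delta> \<rightarrow>\<^sub>E UNIV" "x \<notin> E" for x
  proof (rule RD_signed_permutation[OF matrix_of_entries_carrier[OF \<delta>] PR CR_imp_le_dim_row[OF \<delta> r CR]])
    fix D assume "D \<subseteq> {0..<m}" "card D = s"
    then have D: "D \<in> DD" unfolding DD_def by simp
    have rows: "h ` {0..<r} \<subseteq> {0..<m}" if "\<forall>j<r. (h j, j) \<in> support \<delta>" for h
      using that \<delta> by (auto simp: support_def)
    define A B where "A = F D ` {0..<r}" and "B = G D ` {0..<r}"
    have "A \<subseteq> {0..<m}" "B \<subseteq> {0..<m}"
      unfolding A_def B_def using FG[OF D] by (auto intro!: rows)
    moreover have "A \<inter> B = {}" "(A \<union> B) \<inter> D = {}"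
      unfolding A_def B_def using FG[OF D] by simp_all
    ultimately have "A \<subseteq> {0..<m} - D" "B \<subseteq> {0..<m} - D" "A \<inter> B = {}" by blast+
    moreover have "card A = r" "card B = r"
      unfolding A_def B_def using FG[OF D] by (simp_all add: card_image)
    moreover have "det (row_submatrix (matrix_of_entries \<delta> x) A) \<noteq> 0"
      "det (row_submatrix (matrix_of_entries \<delta> x) B) \<noteq> 0"
      unfolding A_def B_def using x D unfolding E_def by simp_all
    ultimately show "\<exists>A B. A \<subseteq> {0..<m} - D \<and> B \<subseteq> {0..<m} - D \<and> A \<inter> B = {} \<and>
        card A = r \<and> card B = r \<and> det (row_submatrix (matrix_of_entries \<delta> x) A) \<noteq> 0 \<and>
        det (row_submatrix (matrix_of_entries \<delta> x) B) \<noteq> 0"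
      by (intro exI[of _ A] exI[of _ B] conjI)
  qed
  show "{x \<in> support \<delta> \<rightarrow>\<^sub>E UNIV. matrix_of_entries \<delta> x \<in> GLT_matrices \<delta> \<and>
      matrix_of_entries \<delta> x * P * R \<in> {\<beta> \<in> Theta \<delta>. \<not> RD s \<beta>}}
    \<in> null_sets (completion (\<Pi>\<^sub>M ij \<in> support \<delta>. lborel))"
    \<comment> \<open>Only inclusion in the null set \<open>E\<close> is shown; in the completed
      measure every subset of \<open>E\<close> is null.\<close>
    by (rule null_sets_completion_subset[OF _ null_sets_completionI[OF E]]) (use RD in blast)
qed auto

theorem theorem3:
  fixes \<delta> :: "nat mat" and m r s :: nat
  assumes "\<delta> \<in> carrier_mat m r" and "1 \<le> r"
    and "binary_unordered_GLT \<delta>"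
  shows "(\<not> CR s \<delta> \<longrightarrow> (\<forall>\<beta> \<in> Theta \<delta>. \<not> RD s \<beta>)) \<and>
    (CR s \<delta> \<longrightarrow> (\<exists>N. measure_zero_in_Theta \<delta> N \<and> (\<forall>\<beta> \<in> Theta \<delta> - N. RD s \<beta>)))"
proof (intro conjI impI ballI)
  show "\<not> RD s \<beta>" if "\<not> CR s \<delta>" "\<beta> \<in> Theta \<delta>" for \<beta>
    using not_CR_imp_not_RD[OF assms(1) that] .
  show "\<exists>N. measure_zero_in_Theta \<delta> N \<and> (\<forall>\<beta> \<in> Theta \<delta> - N. RD s \<beta>)" if "CR s \<delta>"
    using CR_imp_RD_almost_everywhere[OF assms(1,2) that] by blast
qed

end
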